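(* There is a deterministic algorithm that, given a family of subsets $S_1,\dots,S_m\subseteq[n]$ each of size at least $k$, finds a fractional hitting set of this family of size at most $O(n/k)$ in time $O(n+mk+\frac{n}{k}\log n)$.
   Context: $[n]=\{1,\dots,n\}$. A set $S\subseteq[n]$ is a fractional hitting set of the family $S_1,\dots,S_m$ if $|\{i\in[m]: S\cap S_i\neq\emptyset\}|=\Omega(m)$, i.e. $S$ intersects at least a constant fraction of the sets. *)

theory Defs
  imports Complex_Main
begin

section \<open>Fractional hitting sets\<close>

text \<open>The family \<open>S\<^sub>1, \<dots>, S\<^sub>m\<close> is the restriction of \<open>F\<close> to \<open>{1..m}\<close>, so repeated sets count
  with multiplicity. The constant hidden in \<open>\<Omega>(m)\<close> is the explicit parameter \<open>\<epsilon>\<close>; it has to be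
  positive and chosen uniformly for all instances.\<close>

definition fractional_hitting_set :: "real \<Rightarrow> nat \<Rightarrow> nat \<Rightarrow> (nat \<Rightarrow> nat set) \<Rightarrow> nat set \<Rightarrow> bool" where
  "fractional_hitting_set \<epsilon> n m F S \<longleftrightarrow>
     S \<subseteq> {1..n} \<and> real (card {i \<in> {1..m}. S \<inter> F i \<noteq> {}}) \<ge> \<epsilon> * real m"


section \<open>The word RAM\<close>

text \<open>Running time is counted in instructions of a word RAM with words of \<open>w\<close> bits. Words are
  natural numbers below \<open>2 ^ w\<close>, and all arithmetic is modulo \<open>2 ^ w\<close>. Registers are named by
  the program text, so that a program uses only a fixed number of them; memory is addressed
  indirectly by register contents, so that only the cells below \<open>2 ^ w\<close> are accessible.
  In every instruction the first register is the destination, except that \<open>Store p r\<close> writes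
  the contents of \<open>r\<close> to the cell whose address is in \<open>p\<close>.\<close>

type_synonym reg = nat

datatype instr =
    Const reg nat
  | Move reg reg
  | Add reg reg reg
  | Sub reg reg reg
  | Mul reg reg reg
  | Div reg reg reg
  | Load reg reg
  | Store reg reg
  | Jump nat
  | JumpLess reg reg nat

record ram_state =
  pc :: nat
  regs :: "reg \<Rightarrow> nat"
  mem :: "nat \<Rightarrow> nat"

definition set_reg :: "reg \<Rightarrow> nat \<Rightarrow> ram_state \<Rightarrow> ram_state" where
  "set_reg r v s = s\<lparr>pc := Suc (pc s), regs := (regs s)(r := v)\<rparr>"

fun exec_instr :: "nat \<Rightarrow> instr \<Rightarrow> ram_state \<Rightarrow> ram_state" where
  "exec_instr w (Const r v) s = set_reg r (v mod 2 ^ w) s"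
| "exec_instr w (Move r x) s = set_reg r (regs s x) s"
| "exec_instr w (Add r x y) s = set_reg r ((regs s x + regs s y) mod 2 ^ w) s"
| "exec_instr w (Sub r x y) s = set_reg r (nat ((int (regs s x) - int (regs s y)) mod 2 ^ w)) s"
| "exec_instr w (Mul r x y) s = set_reg r ((regs s x * regs s y) mod 2 ^ w) s"
| "exec_instr w (Div r x y) s = set_reg r (regs s x div regs s y) s"
| "exec_instr w (Load r p) s = set_reg r (mem s (regs s p)) s"
| "exec_instr w (Store p r) s = s\<lparr>pc := Suc (pc s), mem := (mem s)(regs s p := regs s r)\<rparr>"
| "exec_instr w (Jump l) s = s\<lparr>pc := l\<rparr>"
| "exec_instr w (JumpLess x y l) s =
     s\<lparr>pc := (if regs s x < regs s y then l else Suc (pc s))\<rparr>"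

text \<open>A program halts by leaving its own text.\<close>

definition halted :: "instr list \<Rightarrow> ram_state \<Rightarrow> bool" where
  "halted P s \<longleftrightarrow> length P \<le> pc s"

definition step :: "nat \<Rightarrow> instr list \<Rightarrow> ram_state \<Rightarrow> ram_state" where
  "step w P s = (if halted P s then s else exec_instr w (P ! pc s) s)"

definition init_state :: "nat list \<Rightarrow> ram_state" where
  "init_state inp =
     \<lparr>pc = 0, regs = (\<lambda>_. 0), mem = (\<lambda>a. if a < length inp then inp ! a else 0)\<rparr>"

text \<open>The result is an array, given on halting by its address in register 0 and its length in
  register 1.\<close>

definition result_array :: "ram_state \<Rightarrow> nat list" where
  "result_array s = map (mem s) [regs s 0 ..< regs s 0 + regs s 1]"

definition computes_in :: "nat \<Rightarrow> instr list \<Rightarrow> nat list \<Rightarrow> nat \<Rightarrow> nat list \<Rightarrow> bool" where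
  "computes_in w P inp t out \<longleftrightarrow>
     (let s = (step w P ^^ t) (init_state inp)
      in halted P s \<and> regs s 0 + regs s 1 \<le> 2 ^ w \<and> out = result_array s)"


section \<open>Representation of the input and output\<close>

text \<open>A finite set is represented by an array listing its elements in any order, without
  repetition.\<close>

definition lists_set :: "nat list \<Rightarrow> nat set \<Rightarrow> bool" where
  "lists_set xs A \<longleftrightarrow> distinct xs \<and> set xs = A"

text \<open>List positions start at 0, set indices at 1.\<close>

definition lists_family :: "nat list list \<Rightarrow> nat \<Rightarrow> (nat \<Rightarrow> nat set) \<Rightarrow> bool" where
  "lists_family xss m F \<longleftrightarrow> length xss = m \<and> (\<forall>i < m. lists_set (xss ! i) (F (Suc i)))"

text \<open>Memory layout of an instance with \<open>m = length xss\<close> sets: cells 0, 1, 2 contain \<open>n\<close>, \<open>m\<close>,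
  \<open>k\<close>, and cells \<open>3, \<dots>, m + 3\<close> contain addresses \<open>a\<^sub>0, \<dots>, a\<^sub>m\<close> such that the elements of
  \<open>xss ! i\<close> are in the cells \<open>a\<^sub>i, \<dots>, a\<^sub>i\<^sub>+\<^sub>1 - 1\<close>. An algorithm can hence inspect a few elements of
  each set without reading the whole input, as a bound with \<open>m * k\<close> in it requires.\<close>

definition family_input :: "nat \<Rightarrow> nat \<Rightarrow> nat list list \<Rightarrow> nat list" where
  "family_input n k xss =
     (let m = length xss
      in [n, m, k] @ map (\<lambda>i. m + 4 + (\<Sum>j<i. length (xss ! j))) [0..<m + 1] @ concat xss)"

end

theory Submission
  imports Defs
begin

text \<open>Keep only the first \<open>k\<close> elements of each set and put \<open>q = m k div 2n\<close>. Scan \<open>1, \<dots>, n\<close> and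
  choose \<open>v\<close> whenever it lies in more than \<open>q\<close> sets that are not hit yet. Each choice hits at least
  \<open>q + 1 > m k / 2n\<close> new sets, so there are at most \<open>2n/k\<close> choices. The number of unhit sets
  containing \<open>v\<close> never increases, so one pass suffices: at the end every element lies in at most
  \<open>q\<close> unhit sets, and counting incidences leaves at most \<open>n q / k \<le> m/2\<close> sets unhit. With
  linked lists of the occurrences of each element the whole pass takes time \<open>O(n + m k)\<close>, and
  no priority queue is needed.\<close>

section \<open>Reachability with a time bound\<close>

text \<open>An upper bound \<open>t\<close> instead of an exact step count lets branches of
  different lengths share one bound.\<close>

definition reaches ::
  "nat \<Rightarrow> instr list \<Rightarrow> (ram_state \<Rightarrow> bool) \<Rightarrow> nat \<Rightarrow> (ram_state \<Rightarrow> bool) \<Rightarrow> bool" where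
  "reaches w P A t B \<longleftrightarrow> (\<forall>s. A s \<longrightarrow> (\<exists>t' \<le> t. B ((step w P ^^ t') s)))"

lemma reachesI:
  assumes "\<And>s. A s \<Longrightarrow> B ((step w P ^^ t) s)"
  shows "reaches w P A t B"
  using assms unfolding reaches_def by blast

lemma reaches_trans [trans]:
  assumes "reaches w P A t B" "reaches w P B u C"
  shows "reaches w P A (t + u) C"
  unfolding reaches_def
proof (intro allI impI)
  fix s assume "A s"
  then obtain t' where t': "t' \<le> t" "B ((step w P ^^ t') s)"
    using assms(1) unfolding reaches_def by blast
  then obtain u' where "u' \<le> u" "C ((step w P ^^ u') ((step w P ^^ t') s))"
    using assms(2) unfolding reaches_def by blast
  then show "\<exists>t''\<le>t + u. C ((step w P ^^ t'') s)"
    using t'(1) by (intro exI[of _ "u' + t'"]) (simp add: funpow_add)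
qed

lemma reaches_weaken:
  assumes "reaches w P A t B" "\<And>s. A' s \<Longrightarrow> A s" "t \<le> t'" "\<And>s. B s \<Longrightarrow> B' s"
  shows "reaches w P A' t' B'"
  using assms unfolding reaches_def by (meson order_trans)

text \<open>The cost \<open>t i\<close> may vary with the iteration, as the amortised count over
  lists of different lengths requires.\<close>

lemma reaches_for:
  assumes "\<And>i. i < N \<Longrightarrow> reaches w P (I i) (t i) (I (Suc i))"
  shows "reaches w P (I 0) (\<Sum>i<N. t i) (I N)"
  using assms
proof (induction N)
  case 0
  show ?case by (simp add: reaches_def)
next
  case (Suc N)
  have "reaches w P (I 0) (\<Sum>i<N. t i) (I N)"
    by (rule Suc.IH) (simp add: Suc.prems)
  from reaches_trans[OF this Suc.prems[of N]] show ?case by simp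
qed

text \<open>Peeling off the first step lets the simplifier run the program forwards from a known
  state.\<close>

lemma funpow_numeral_apply: "(f ^^ numeral l) s = (f ^^ pred_numeral l) (f s)"
  by (simp add: numeral_eq_Suc funpow_swap1)

text \<open>Replaces the default rule for \<open>Sub\<close>, whose \<open>int\<close> subtraction the simplifier does not
  turn back into \<open>nat\<close>.\<close>

lemma exec_instr_Sub:
  assumes "regs s y \<le> regs s x" "regs s x < 2 ^ w"
  shows "exec_instr w (Sub r x y) s = set_reg r (regs s x - regs s y) s"
proof -
  have "int (regs s x) - int (regs s y) = int (regs s x - regs s y)" using assms by simp
  moreover have "int (regs s x - regs s y) mod 2 ^ w = int ((regs s x - regs s y) mod 2 ^ w)"
    by (simp add: zmod_int)
  ultimately have "nat ((int (regs s x) - int (regs s y)) mod 2 ^ w) = regs s x - regs s y"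
    using assms by simp
  then show ?thesis by simp
qed

declare exec_instr.simps(4) [simp del]


section \<open>The program\<close>

text \<open>Register 0 is the address of the output and register 1 its length; 2, 3, 4 contain
  \<open>n\<close>, \<open>m\<close>, \<open>k\<close>; 5, 6, 18 contain the constants 1, 0, 3; 7, 8, 9 are the addresses of the list
  heads, the list links and the flags of the sets hit so far; 10 and 11 contain \<open>m * k\<close> and the
  threshold. Register 12 is the counter of both outer loops, whose heads are at 15 and 32; the
  loops at 38 and 56 traverse the list of the element in register 12.\<close>

definition hitting_program :: "instr list" where
  "hitting_program =
    [Const 5 1, Load 2 6, Load 3 5, Const 14 2, Load 4 14, Const 18 3, Add 14 18 3, Load 7 14,
     Add 9 7 2, Add 9 9 5, Add 8 9 3, Mul 10 3 4, Add 0 8 10, Add 14 2 2, Div 11 10 14,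
     JumpLess 12 10 18, Const 12 0, Jump 32,
     Div 13 12 4, Mul 14 13 4, Sub 14 12 14, Add 15 18 13, Load 15 15, Add 15 15 14, Load 15 15,
     Add 15 7 15, Load 14 15, Add 13 8 12, Store 13 14, Add 12 12 5, Store 15 12, Jump 15,
     JumpLess 12 2 34, Jump 65,
     Add 12 12 5, Add 13 7 12, Load 13 13, Const 15 0,
     JumpLess 6 13 40, Jump 49,
     Sub 13 13 5, Div 16 13 4, Add 16 9 16, Load 17 16, Sub 17 5 17, Add 15 15 17, Add 16 8 13,
     Load 13 16, Jump 38,
     JumpLess 11 15 51, Jump 32,
     Add 16 0 1, Store 16 12, Add 1 1 5, Add 13 7 12, Load 13 13,
     JumpLess 6 13 58, Jump 32,
     Sub 13 13 5, Div 16 13 4, Add 16 9 16, Store 16 5, Add 16 8 13, Load 13 16, Jump 56]"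

lemma length_hitting_program [simp]: "length hitting_program = 65"
  by (simp add: hitting_program_def)

lemma step_hitting_program:
  "pc s < 65 \<Longrightarrow> step w hitting_program s = exec_instr w (hitting_program ! pc s) s"
  by (simp add: step_def halted_def)

lemma map_nth_hitting_program: "map ((!) hitting_program) [0..<65] = hitting_program"
  using map_nth[of hitting_program] by simp

text \<open>Equating two explicit lists entry by entry yields all 65 lookups as rewrite
  rules.\<close>

lemmas hitting_program_nth =
  trans[OF map_nth_hitting_program hitting_program_def,
    simplified upt_conv_Cons list.map numeral_2_eq_2[symmetric], simplified]

lemmas symbolic_step =
  funpow_numeral_apply step_hitting_program set_reg_def hitting_program_nth exec_instr_Sub
  numeral_2_eq_2[symmetric]


section \<open>Instances\<close>

lemma nth_concat_prefix_sum:
  assumes "i < length xss" "j < length (xss ! i)"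
  shows "(\<Sum>l<i. length (xss ! l)) + j < length (concat xss)"
    and "concat xss ! ((\<Sum>l<i. length (xss ! l)) + j) = xss ! i ! j"
proof -
  have "(\<Sum>l<i. length (xss ! l)) + j < length (concat xss) \<and>
        concat xss ! ((\<Sum>l<i. length (xss ! l)) + j) = xss ! i ! j"
    using assms
  proof (induction xss arbitrary: i)
    case (Cons xs xss)
    show ?case
    proof (cases i)
      case 0
      then show ?thesis using Cons.prems by (simp add: nth_append)
    next
      case (Suc i')
      then show ?thesis using Cons.IH[of i'] Cons.prems
        by (simp add: sum.lessThan_Suc_shift nth_append add.assoc del: sum.lessThan_Suc)
    qed
  qed simp
  then show "(\<Sum>l<i. length (xss ! l)) + j < length (concat xss)"
    and "concat xss ! ((\<Sum>l<i. length (xss ! l)) + j) = xss ! i ! j" by auto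
qed

lemma length_concat_sum: "length (concat xss) = (\<Sum>l<length xss. length (xss ! l))"
  by (induction xss) (simp_all add: sum.lessThan_Suc_shift del: sum.lessThan_Suc)

locale hitting_instance =
  fixes n m k w :: nat and xss :: "nat list list"
  assumes n_pos: "n \<ge> 1" and k_pos: "k \<ge> 1"
    and length_xss: "length xss = m"
    and distinct_xss: "i < m \<Longrightarrow> distinct (xss ! i)"
    and set_xss: "i < m \<Longrightarrow> set (xss ! i) \<subseteq> {1..n}"
    and k_le_xss: "i < m \<Longrightarrow> k \<le> length (xss ! i)"
    and word_size: "2 * (n + k + length (family_input n k xss)) \<le> 2 ^ w"
begin

abbreviation "inp \<equiv> family_input n k xss"

definition "q = m * k div (2 * n)"
text \<open>The work memory follows the input in consecutive blocks: list heads, flags, links,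
  output. The first has \<open>n + 1\<close> cells, so that element \<open>v\<close> sits at offset
  \<open>v\<close>.\<close>

definition "heads = length inp"
definition "flags = heads + n + 1"
definition "links = flags + m"
definition "outs = links + m * k"

text \<open>Occurrences in the first \<open>k\<close> elements of the sets are numbered consecutively.\<close>

definition "elt e = xss ! (e div k) ! (e mod k)"

text \<open>Descending order, because the program inserts each new occurrence at the front of its
  linked list.\<close>

primrec occs :: "nat \<Rightarrow> nat \<Rightarrow> nat list" where
  "occs 0 v = []"
| "occs (Suc e) v = (if elt e = v then e # occs e v else occs e v)"

definition "owners v = (\<lambda>e. e div k) ` set (occs (m * k) v)"

text \<open>Occurrences are counted, as in a traversal of the linked list;
  \<open>unhit_eq_card_owners\<close> turns this into a number of sets.\<close>

definition "unhit X v = length (filter (\<lambda>e. e div k \<notin> X) (occs (m * k) v))"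

primrec greedy :: "nat \<Rightarrow> nat set \<times> nat list" where
  "greedy 0 = ({}, [])"
| "greedy (Suc v) =
     (let (X, out) = greedy v
      in if q < unhit X (Suc v) then (X \<union> owners (Suc v), out @ [Suc v]) else (X, out))"

abbreviation "hit v \<equiv> fst (greedy v)"
abbreviation "chosen v \<equiv> snd (greedy v)"

lemma greedy_Suc:
  "hit (Suc v) = (if q < unhit (hit v) (Suc v) then hit v \<union> owners (Suc v) else hit v)"
  "chosen (Suc v) = (if q < unhit (hit v) (Suc v) then chosen v @ [Suc v] else chosen v)"
  by (simp_all add: case_prod_beta Let_def)

declare greedy.simps(2) [simp del]

subsection \<open>Occurrences\<close>

lemma set_occs: "set (occs E v) = {e. e < E \<and> elt e = v}"
  by (induction E) (auto simp: less_Suc_eq)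

lemma distinct_occs: "distinct (occs E v)"
  by (induction E) (auto simp: set_occs)

text \<open>The tail does not depend on \<open>E\<close>. Hence the link stored with
  \<open>e\<close> stays valid under later insertions, and an induction along the list can pass from
  \<open>E\<close> to \<open>e\<close>.\<close>

lemma occs_ConsD:
  assumes "occs E v = e # es"
  shows "e < E" "elt e = v" "es = occs e v"
proof -
  have "e < E \<and> elt e = v \<and> es = occs e v"
    using assms by (induction E) (auto split: if_splits)
  then show "e < E" "elt e = v" "es = occs e v" by auto
qed

lemma div_less_m: "e < m * k \<Longrightarrow> e div k < m"
  using k_pos by (simp add: less_mult_imp_div_less)

lemma mod_less_length:
  assumes "e < m * k" shows "e mod k < length (xss ! (e div k))"
proof -
  have "e mod k < k" using k_pos by simp
  also have "k \<le> length (xss ! (e div k))" using assms by (intro k_le_xss div_less_m)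
  finally show ?thesis .
qed

lemma elt_mem: "e < m * k \<Longrightarrow> elt e \<in> set (xss ! (e div k))"
  unfolding elt_def by (intro nth_mem mod_less_length)

lemma elt_range:
  assumes "e < m * k" shows "1 \<le> elt e" "elt e \<le> n"
  using elt_mem[OF assms] set_xss[OF div_less_m[OF assms]] by auto

text \<open>The lists are distinct, so each set supplies at most one occurrence of \<open>v\<close>:
  equal quotients force equal remainders.\<close>

lemma inj_on_div: "inj_on (\<lambda>e. e div k) (set (occs (m * k) v))"
proof (rule inj_onI)
  fix e e' assume e: "e \<in> set (occs (m * k) v)" "e' \<in> set (occs (m * k) v)"
    and eq: "e div k = e' div k"
  have "e mod k = e' mod k"
    using e eq distinct_xss[of "e div k"] div_less_m[of e] mod_less_length[of e]
      mod_less_length[of e']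
    by (auto simp: set_occs elt_def nth_eq_iff_index_eq)
  then show "e = e'" using eq by (metis div_mult_mod_eq)
qed

lemma unhit_eq_card: "unhit X v = card {e. e < m * k \<and> elt e = v \<and> e div k \<notin> X}"
proof -
  have "unhit X v = card (set (filter (\<lambda>e. e div k \<notin> X) (occs (m * k) v)))"
    unfolding unhit_def by (intro distinct_card[symmetric] distinct_filter distinct_occs)
  also have "set (filter (\<lambda>e. e div k \<notin> X) (occs (m * k) v)) =
      {e. e < m * k \<and> elt e = v \<and> e div k \<notin> X}"
    by (auto simp: set_occs)
  finally show ?thesis .
qed

lemma unhit_eq_card_owners: "unhit X v = card (owners v - X)"
proof -
  have "owners v - X = (\<lambda>e. e div k) ` {e. e < m * k \<and> elt e = v \<and> e div k \<notin> X}"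
    by (auto simp: owners_def set_occs)
  moreover have "inj_on (\<lambda>e. e div k) {e. e < m * k \<and> elt e = v \<and> e div k \<notin> X}"
    by (rule inj_on_subset[OF inj_on_div[of v]]) (auto simp: set_occs)
  ultimately show ?thesis by (simp add: card_image unhit_eq_card)
qed

text \<open>Double counting: the fibres of \<open>elt\<close> over \<open>{1..n}\<close> partition
  the occurrences.\<close>

lemma sum_unhit: "(\<Sum>v=1..n. unhit X v) = card {e. e < m * k \<and> e div k \<notin> X}"
proof -
  have "{e. e < m * k \<and> e div k \<notin> X} =
      (\<Union>v\<in>{1..n}. {e. e < m * k \<and> elt e = v \<and> e div k \<notin> X})"
    using elt_range by fastforce
  also have "card \<dots> = (\<Sum>v=1..n. card {e. e < m * k \<and> elt e = v \<and> e div k \<notin> X})"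
    by (rule card_UN_disjoint) auto
  finally show ?thesis by (simp add: unhit_eq_card)
qed

text \<open>The case \<open>X = {}\<close> of the double count. It bounds the cost of all traversals
  together, although a single list may be long.\<close>

lemma sum_length_occs: "(\<Sum>v<n. length (occs (m * k) (Suc v))) = m * k"
proof -
  have "(\<Sum>v<n. length (occs (m * k) (Suc v))) = (\<Sum>v=1..n. unhit {} v)"
    by (rule sum.reindex_bij_witness[of _ "\<lambda>v. v - 1" Suc]) (auto simp: unhit_def)
  then show ?thesis by (simp only: sum_unhit) simp
qed

text \<open>Each index \<open>i\<close> outside \<open>X\<close> contributes the block of
  \<open>k\<close> numbers \<open>i * k + j\<close> with \<open>j < k\<close>.\<close>

lemma card_unhit_ge:
  assumes "X \<subseteq> {..<m}"
  shows "(m - card X) * k \<le> card {e. e < m * k \<and> e div k \<notin> X}"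
proof -
  let ?f = "\<lambda>(i, j). i * k + j"
  have "inj_on ?f (({..<m} - X) \<times> {..<k})"
  proof (rule inj_onI, clarify)
    fix a b c d assume "b < k" "d < k" and eq: "a * k + b = c * k + d"
    then have "a = c" by (metis div_mult_self3 div_less add_0_right less_nat_zero_code)
    then show "a = c \<and> b = d" using eq by simp
  qed
  moreover have "?f ` (({..<m} - X) \<times> {..<k}) \<subseteq> {e. e < m * k \<and> e div k \<notin> X}"
  proof (clarify, intro conjI)
    fix i j assume "i < m" "j < k" and "i \<notin> X"
    have "i * k + j < Suc i * k" using \<open>j < k\<close> by simp
    also have "\<dots> \<le> m * k" using \<open>i < m\<close> by (intro mult_le_mono1) simp
    finally show "i * k + j < m * k" .
    show "(i * k + j) div k \<notin> X" using \<open>j < k\<close> \<open>i \<notin> X\<close> by simp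
  qed
  ultimately have "card (({..<m} - X) \<times> {..<k}) \<le> card {e. e < m * k \<and> e div k \<notin> X}"
    by (rule card_inj_on_le) simp
  then show ?thesis using assms
    by (simp add: card_cartesian_product card_Diff_subset finite_subset)
qed


subsection \<open>The greedy choice\<close>

lemma owners_subset: "owners v \<subseteq> {..<m}"
  by (auto simp: owners_def set_occs div_less_m)

lemma hit_subset: "hit v \<subseteq> {..<m}"
  using owners_subset by (induction v) (auto simp: greedy_Suc)

lemma finite_hit: "finite (hit v)"
  using hit_subset finite_subset by blast

lemma hit_mono: "u \<le> v \<Longrightarrow> hit u \<subseteq> hit v"
  by (induction v rule: dec_induct) (auto simp: greedy_Suc)

lemma set_chosen: "set (chosen v) \<subseteq> {1..v}"
  by (induction v) (auto simp: greedy_Suc)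

lemma distinct_chosen: "distinct (chosen v)"
  using set_chosen by (induction v) (fastforce simp: greedy_Suc)+

lemma length_chosen_le: "length (chosen v) \<le> v"
  by (induction v) (auto simp: greedy_Suc)

lemma hit_eq: "hit v = (\<Union>u\<in>set (chosen v). owners u)"
  by (induction v) (auto simp: greedy_Suc)

lemma length_chosen_mult_le: "length (chosen v) * Suc q \<le> card (hit v)"
proof (induction v)
  case (Suc v)
  have "card (hit v \<union> owners (Suc v)) = card (hit v) + card (owners (Suc v) - hit v)"
    using owners_subset[of "Suc v"] finite_hit finite_subset
    by (metis Diff_disjoint Un_Diff_cancel card_Un_disjoint finite_Diff finite_lessThan)
  then show ?case using Suc by (auto simp: greedy_Suc unhit_eq_card_owners)
qed simp

text \<open>Right after step \<open>u\<close> the bound holds: either \<open>u\<close> was chosen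
  and all its owners are hit, or its count failed the test. Later steps only enlarge the set of hit
  indices.\<close>

lemma unhit_le:
  assumes "1 \<le> u" "u \<le> v"
  shows "unhit (hit v) u \<le> q"
proof -
  obtain u' where u: "u = Suc u'" using assms by (cases u) auto
  have "unhit (hit u) u \<le> q"
    using finite_subset[OF owners_subset]
    by (auto simp: u greedy_Suc unhit_eq_card_owners Diff_eq_empty_iff[THEN iffD2])
  moreover have "unhit (hit v) u \<le> unhit (hit u) u"
    unfolding unhit_eq_card using hit_mono[OF assms(2)] by (intro card_mono) auto
  ultimately show ?thesis by simp
qed

lemma card_hit_ge: "m \<le> 2 * card (hit n)"
proof -
  have "(m - card (hit n)) * k \<le> card {e. e < m * k \<and> e div k \<notin> hit n}"
    by (rule card_unhit_ge[OF hit_subset])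
  also have "\<dots> = (\<Sum>v=1..n. unhit (hit n) v)" by (simp only: sum_unhit)
  also have "\<dots> \<le> (\<Sum>v=1..n. q)" by (intro sum_mono unhit_le) auto
  also have "\<dots> = n * q" by simp
  finally have "2 * ((m - card (hit n)) * k) \<le> 2 * n * q" by simp
  also have "\<dots> \<le> m * k" by (simp add: q_def)
  finally have "(2 * (m - card (hit n))) * k \<le> m * k" by (simp add: mult.assoc)
  then show ?thesis using k_pos by simp
qed

lemma length_chosen_mult_k: "length (chosen n) * k \<le> 2 * n"
\<comment> \<open>The inequality is proved multiplied by \<open>m\<close>, so \<open>m = 0\<close>
  is treated apart; nothing can be hit then, and \<open>length_chosen_mult_le\<close> forces an
  empty output.\<close>
proof (cases "m = 0")
  case True
  then have "hit n = {}" using hit_subset[of n] by simp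
  then show ?thesis using length_chosen_mult_le[of n] by simp
next
  case False
  \<comment> \<open>Rounding down in \<open>q\<close> loses less than one unit.\<close>
  have "m * k < 2 * n * Suc q"
    unfolding q_def using n_pos by (metis dividend_less_times_div mult_Suc_right add.commute
      less_le_trans less_numeral_extra(1) nat_0_less_mult_iff zero_less_numeral)
  then have "length (chosen n) * (m * k) \<le> length (chosen n) * (2 * n * Suc q)"
    by (intro mult_le_mono2) simp
  also have "\<dots> = 2 * n * (length (chosen n) * Suc q)" by (simp only: ac_simps)
  also have "\<dots> \<le> 2 * n * m"
    using length_chosen_mult_le[of n] card_mono[OF _ hit_subset[of n]]
    by (intro mult_le_mono2) simp
  finally have "m * (length (chosen n) * k) \<le> m * (2 * n)" by (simp only: ac_simps)
  then show ?thesis using False by simp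
qed


subsection \<open>Memory layout\<close>

lemma heads_eq: "heads = m + 4 + (\<Sum>l<m. length (xss ! l))"
  by (simp add: heads_def family_input_def Let_def length_concat_sum length_xss del: length_concat)

text \<open>Each list has at least \<open>k\<close> entries, so a table of \<open>m * k\<close>
  links is no longer than the input.\<close>

lemma mk_le: "m + 4 + m * k \<le> heads"
proof -
  have "(\<Sum>l<m. k) \<le> (\<Sum>l<m. length (xss ! l))" by (intro sum_mono k_le_xss) simp
  then show ?thesis by (simp add: heads_eq)
qed

lemma inp_nth:
  "inp ! 0 = n" "inp ! Suc 0 = m" "inp ! 2 = k"
  "i \<le> m \<Longrightarrow> inp ! (3 + i) = m + 4 + (\<Sum>l<i. length (xss ! l))"
proof -
  show "inp ! 0 = n" "inp ! Suc 0 = m" "inp ! 2 = k"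
    by (simp_all add: family_input_def Let_def length_xss)
  assume "i \<le> m"
  then show "inp ! (3 + i) = m + 4 + (\<Sum>l<i. length (xss ! l))"
    by (simp add: family_input_def Let_def length_xss nth_append nth_Cons' del: upt_Suc)
qed

text \<open>This is the double indirection of the program: the address table gives the start of a
  list, and the offset \<open>e mod k\<close> is within that list. The bound places the read below
  the work memory.\<close>

lemma inp_nth_elt:
  assumes "e < m * k"
  shows "inp ! (3 + e div k) + e mod k < heads"
    and "inp ! (inp ! (3 + e div k) + e mod k) = elt e"
proof -
  have e: "e div k < m" by (rule div_less_m[OF assms])
  let ?a = "(\<Sum>l<e div k. length (xss ! l)) + e mod k"
  have a: "inp ! (3 + e div k) + e mod k = m + 4 + ?a" using e by (simp add: inp_nth)
  have c: "?a < length (concat xss)" "concat xss ! ?a = elt e"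
    using nth_concat_prefix_sum[of "e div k" xss "e mod k"] e mod_less_length[OF assms]
    by (simp_all add: length_xss elt_def)
  show "inp ! (3 + e div k) + e mod k < heads"
    using a c(1) by (simp add: heads_eq length_concat_sum length_xss del: length_concat)
  have "inp ! (m + 4 + ?a) = concat xss ! ?a"
    by (simp add: family_input_def Let_def length_xss nth_append nth_Cons' del: upt_Suc)
  then show "inp ! (inp ! (3 + e div k) + e mod k) = elt e" using a c(2) by (simp only:)
qed

lemma size_bound: "2 * (n + k + heads) \<le> 2 ^ w"
  using word_size by (simp add: heads_def)

text \<open>This explains the factor 2 in \<open>word_size\<close>: one copy of \<open>heads\<close>
  covers the input, the other covers flags and links by \<open>mk_le\<close>, and
  \<open>2 * n\<close> covers list heads and output.\<close>

lemma outs_bound: "outs + n < 2 ^ w"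
  using size_bound mk_le k_pos by (simp add: outs_def links_def flags_def)


lemma layout_bounds:
  "v \<le> n \<Longrightarrow> heads + v < 2 ^ w" "heads + n + 1 < 2 ^ w" "i < m \<Longrightarrow> flags + i < 2 ^ w"
  "flags + m < 2 ^ w" "e < m * k \<Longrightarrow> links + e < 2 ^ w" "links + m * k < 2 ^ w"
  "j \<le> n \<Longrightarrow> outs + j < 2 ^ w" "Suc n < 2 ^ w" "m + 3 < 2 ^ w" "m * k < 2 ^ w" "heads < 2 ^ w"
  "2 * n < 2 ^ w" "3 < (2 :: nat) ^ w"
  using outs_bound size_bound mk_le k_pos
  by (auto simp: outs_def links_def flags_def)

subsection \<open>Correctness of the program\<close>

text \<open>Links are shifted by 1, so that 0, the initial content of the memory, is the null link.\<close>

definition latest :: "nat list \<Rightarrow> nat" where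
  "latest es = (case es of [] \<Rightarrow> 0 | e # _ \<Rightarrow> Suc e)"

definition constants :: "ram_state \<Rightarrow> bool" where
  "constants s \<longleftrightarrow> regs s 0 = outs \<and> regs s 2 = n \<and> regs s 3 = m \<and> regs s 4 = k \<and> regs s 5 = 1 \<and>
     regs s 6 = 0 \<and> regs s 7 = heads \<and> regs s 8 = links \<and> regs s 9 = flags \<and>
     regs s 10 = m * k \<and> regs s 11 = q \<and> regs s 18 = 3"

definition linked :: "nat \<Rightarrow> ram_state \<Rightarrow> bool" where
  "linked E s \<longleftrightarrow> (\<forall>v. 1 \<le> v \<and> v \<le> n \<longrightarrow> mem s (heads + v) = latest (occs E v)) \<and>
     (\<forall>e < E. mem s (links + e) = latest (occs e (elt e)))"

definition flagged :: "nat set \<Rightarrow> ram_state \<Rightarrow> bool" where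
  "flagged X s \<longleftrightarrow> (\<forall>i < m. mem s (flags + i) = (if i \<in> X then 1 else 0))"

definition emitted :: "nat list \<Rightarrow> ram_state \<Rightarrow> bool" where
  "emitted out s \<longleftrightarrow> regs s 1 = length out \<and> (\<forall>j < length out. mem s (outs + j) = out ! j)"

text \<open>The loop that builds the lists is the last phase to read the input; hence only
  \<open>building\<close> has a clause on the input cells.\<close>

definition building :: "nat \<Rightarrow> ram_state \<Rightarrow> bool" where
  "building e s \<longleftrightarrow> pc s = 15 \<and> constants s \<and> regs s 12 = e \<and> linked e s \<and> flagged {} s \<and>
     emitted [] s \<and> (\<forall>a < heads. mem s a = inp ! a)"

definition choosing :: "nat \<Rightarrow> nat \<Rightarrow> nat set \<Rightarrow> nat list \<Rightarrow> ram_state \<Rightarrow> bool" where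
  "choosing l v X out s \<longleftrightarrow> pc s = l \<and> constants s \<and> regs s 12 = v \<and> linked (m * k) s \<and>
     flagged X s \<and> emitted out s"

section \<open>Building the linked lists of occurrences\<close>

lemma reaches_building_0:
  "reaches w hitting_program (\<lambda>s. s = init_state inp) 15 (building 0)"
proof (rule reachesI)
  fix s assume s: "s = init_state inp"
  have len: "length inp = heads" "4 \<le> heads" "3 + m < heads"
    using mk_le by (auto simp: heads_def)
  \<comment> \<open>Cell \<open>3 + m\<close> holds the end address of the last list, which is the
    first free cell.\<close>
  have rd: "mem s 0 = n" "mem s (Suc 0) = m" "mem s 2 = k" "mem s (3 + m) = heads"
    "pc s = 0" "regs s = (\<lambda>_. 0)"
    and mem: "\<And>a. a < heads \<Longrightarrow> mem s a = inp ! a"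
    "\<And>a. heads \<le> a \<Longrightarrow> mem s a = 0"
    using len by (auto simp: s init_state_def inp_nth heads_eq)
  have bd: "w \<noteq> 0" "2 < (2 :: nat) ^ w" "3 + m < 2 ^ w" "heads + n < 2 ^ w"
    "Suc (heads + n) < 2 ^ w" "n + n < 2 ^ w" "3 < (2 :: nat) ^ w"
    "flags < 2 ^ w" "links < 2 ^ w" "outs < 2 ^ w"
    using layout_bounds(2,4,6,7,9,12,13) by (cases w; simp add: links_def outs_def)+
  have eq: "Suc (heads + n) = flags" "flags + m = links" "links + m * k = outs"
    "m * k div (n + n) = q"
    by (simp_all add: outs_def links_def flags_def q_def mult_2)
  have "(step w hitting_program ^^ 15) s = s\<lparr>pc := 15, regs := (\<lambda>_. 0)
      (5 := 1, 2 := n, 3 := m, 4 := k, 18 := 3, 7 := heads, 9 := flags, 8 := links, 10 := m * k,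
       0 := outs, 14 := n + n, 11 := q)\<rparr>"
    by (simp add: symbolic_step rd bd eq layout_bounds(10,11))
  \<comment> \<open>Memory beyond the input is initially 0, which already encodes empty lists and
    clear flags.\<close>
  then show "building 0 ((step w hitting_program ^^ 15) s)"
    using rd mem by (simp add: building_def constants_def linked_def flagged_def emitted_def
      latest_def flags_def)
qed

lemma reaches_building_Suc:
  assumes e: "e < m * k"
  shows "reaches w hitting_program (building e) 15 (building (Suc e))"
proof (rule reachesI)
  fix s assume s: "building e s"
  have regs: "pc s = 15" "constants s" "regs s 12 = e" using s by (auto simp: building_def)
  define a where "a = inp ! (3 + e div k)"
  define v where "v = elt e"
  have v: "1 \<le> v" "v \<le> n" using elt_range[OF e] by (auto simp: v_def)
  have "3 + e div k < heads" using div_less_m[OF e] mk_le by linarith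
  then have rd: "mem s (3 + e div k) = a" "mem s (a + e mod k) = v"
    and bd: "3 + e div k < 2 ^ w" "a + e mod k < 2 ^ w"
    using s inp_nth_elt[OF e] layout_bounds(11) by (auto simp: building_def a_def v_def)
  \<comment> \<open>The machine has no remainder instruction; \<open>e mod k\<close> is computed as
    \<open>e - e div k * k\<close>, and the product must fit into a word.\<close>
  have "e div k * k \<le> e" by simp
  then have bd': "heads + v < 2 ^ w" "links + e < 2 ^ w" "e < 2 ^ w" "Suc e < 2 ^ w"
    "e div k * k < 2 ^ w"
    using v e layout_bounds(1)[of v] layout_bounds(5)[of e] layout_bounds(10) by linarith+
  have "(step w hitting_program ^^ 15) s = s\<lparr>pc := 15, regs := (regs s)
      (15 := heads + v, 14 := mem s (heads + v), 13 := links + e, 12 := Suc e),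
      mem := (mem s)(links + e := mem s (heads + v), heads + v := Suc e)\<rparr>"
    using regs unfolding constants_def
    by (simp add: symbolic_step rd bd bd' e minus_div_mult_eq_mod)
  then show "building (Suc e) ((step w hitting_program ^^ 15) s)"
    using s v e
    by (simp add: building_def constants_def linked_def flagged_def emitted_def
      latest_def flags_def links_def v_def less_Suc_eq)
qed

section \<open>The selection pass\<close>

lemma reaches_choosing_0:
  "reaches w hitting_program (building (m * k)) 3 (choosing 32 0 {} [])"
proof (rule reachesI)
  fix s assume s: "building (m * k) s"
  then have "(step w hitting_program ^^ 3) s = s\<lparr>pc := 32, regs := (regs s)(12 := 0)\<rparr>"
    by (simp add: symbolic_step building_def constants_def)
  then show "choosing 32 0 {} [] ((step w hitting_program ^^ 3) s)"
    using s by (simp add: building_def choosing_def constants_def linked_def flagged_def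
      emitted_def)
qed

lemma reaches_list_start:
  assumes v: "v < n"
  shows "reaches w hitting_program (choosing 32 v X out) 5
    (\<lambda>s. choosing 38 (Suc v) X out s \<and> regs s 13 = latest (occs (m * k) (Suc v)) \<and> regs s 15 = 0)"
proof (rule reachesI)
  fix s assume s: "choosing 32 v X out s"
  have bd: "Suc v < 2 ^ w" "Suc (heads + v) < 2 ^ w"
    using v layout_bounds(8) layout_bounds(1)[of "Suc v"] by auto
  have rd: "mem s (Suc (heads + v)) = latest (occs (m * k) (Suc v))"
    using s v by (auto simp: choosing_def linked_def simp flip: add_Suc_right)
  have "(step w hitting_program ^^ 5) s = s\<lparr>pc := 38, regs := (regs s)
      (12 := Suc v, 13 := latest (occs (m * k) (Suc v)), 15 := 0)\<rparr>"
    using s rd bd v unfolding choosing_def constants_def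
    by (simp add: symbolic_step)
  then show "choosing 38 (Suc v) X out ((step w hitting_program ^^ 5) s) \<and>
      regs ((step w hitting_program ^^ 5) s) 13 = latest (occs (m * k) (Suc v)) \<and>
      regs ((step w hitting_program ^^ 5) s) 15 = 0"
    using s by (simp add: choosing_def constants_def linked_def flagged_def emitted_def)
qed

text \<open>Stated for any \<open>E\<close> and any counter value \<open>c\<close>, so that the
  induction hypothesis applies to the tail \<open>occs e v\<close>. The bound on
  \<open>c + length es\<close> prevents overflow of the counter.\<close>

lemma reaches_count:
  assumes "occs E v = es" "E \<le> m * k" "c + length es \<le> m * k"
  shows "reaches w hitting_program
    (\<lambda>s. choosing 38 v X out s \<and> regs s 13 = latest es \<and> regs s 15 = c) (10 * length es + 2)
    (\<lambda>s. choosing 49 v X out s \<and> regs s 15 = c + length (filter (\<lambda>e. e div k \<notin> X) es))"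
  using assms
proof (induction es arbitrary: E c)
  case Nil
  show ?case
  proof (rule reachesI)
    fix s assume s: "choosing 38 v X out s \<and> regs s 13 = latest [] \<and> regs s 15 = c"
    then have "(step w hitting_program ^^ (10 * length [] + 2)) s = s\<lparr>pc := 49\<rparr>"
      by (simp add: symbolic_step choosing_def constants_def latest_def)
    then show "choosing 49 v X out ((step w hitting_program ^^ (10 * length [] + 2)) s) \<and>
        regs ((step w hitting_program ^^ (10 * length [] + 2)) s) 15 =
          c + length (filter (\<lambda>e. e div k \<notin> X) [])"
      using s by (simp add: choosing_def constants_def linked_def flagged_def emitted_def)
  qed
next
  case (Cons e es)
  note e = occs_ConsD[OF Cons.prems(1)]
  have em: "e < m * k" using e(1) Cons.prems(2) by simp
  let ?c = "if e div k \<in> X then c else Suc c"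
  have "reaches w hitting_program
      (\<lambda>s. choosing 38 v X out s \<and> regs s 13 = latest (e # es) \<and> regs s 15 = c) 10
      (\<lambda>s. choosing 38 v X out s \<and> regs s 13 = latest es \<and> regs s 15 = ?c)"
  proof (rule reachesI)
    fix s assume s: "choosing 38 v X out s \<and> regs s 13 = latest (e # es) \<and> regs s 15 = c"
    have rd: "mem s (flags + e div k) = (if e div k \<in> X then 1 else 0)"
      "mem s (links + e) = latest es"
      using s em e div_less_m[OF em] by (auto simp: choosing_def flagged_def linked_def)
    have bd: "flags + e div k < 2 ^ w" "links + e < 2 ^ w" "Suc e < 2 ^ w" "c < 2 ^ w"
      "Suc c < 2 ^ w" "Suc 0 < 2 ^ w"
      using em Cons.prems(3) div_less_m[OF em] layout_bounds(3)[of "e div k"]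
        layout_bounds(5)[of e] layout_bounds(10) by auto
    have "(step w hitting_program ^^ 10) s = s\<lparr>pc := 38, regs := (regs s)
        (17 := if e div k \<in> X then 0 else 1, 15 := ?c, 16 := links + e, 13 := latest es)\<rparr>"
      using s rd bd unfolding choosing_def constants_def
      by (simp add: symbolic_step latest_def[of "e # es"])
    then show "choosing 38 v X out ((step w hitting_program ^^ 10) s) \<and>
        regs ((step w hitting_program ^^ 10) s) 13 = latest es \<and>
        regs ((step w hitting_program ^^ 10) s) 15 = ?c"
      using s by (simp add: choosing_def constants_def linked_def flagged_def emitted_def)
  qed
  moreover have "reaches w hitting_program
      (\<lambda>s. choosing 38 v X out s \<and> regs s 13 = latest es \<and> regs s 15 = ?c) (10 * length es + 2)
      (\<lambda>s. choosing 49 v X out s \<and> regs s 15 = ?c + length (filter (\<lambda>e. e div k \<notin> X) es))"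
    using Cons.prems em e by (intro Cons.IH[of e]) auto
  ultimately show ?case by (rule reaches_trans[THEN reaches_weaken]) auto
qed

lemma reaches_mark:
  assumes "occs E v = es" "E \<le> m * k"
  shows "reaches w hitting_program
    (\<lambda>s. choosing 56 v X out s \<and> regs s 13 = latest es) (8 * length es + 2)
    (choosing 32 v (X \<union> (\<lambda>e. e div k) ` set es) out)"
  using assms
proof (induction es arbitrary: E X)
  case Nil
  show ?case
  proof (rule reachesI)
    fix s assume s: "choosing 56 v X out s \<and> regs s 13 = latest []"
    then have "(step w hitting_program ^^ (8 * length [] + 2)) s = s\<lparr>pc := 32\<rparr>"
      by (simp add: symbolic_step choosing_def constants_def latest_def)
    then show "choosing 32 v (X \<union> (\<lambda>e. e div k) ` set []) out
        ((step w hitting_program ^^ (8 * length [] + 2)) s)"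
      using s by (simp add: choosing_def constants_def linked_def flagged_def emitted_def)
  qed
next
  case (Cons e es)
  note e = occs_ConsD[OF Cons.prems(1)]
  have em: "e < m * k" using e(1) Cons.prems(2) by simp
  have "reaches w hitting_program
      (\<lambda>s. choosing 56 v X out s \<and> regs s 13 = latest (e # es)) 8
      (\<lambda>s. choosing 56 v (insert (e div k) X) out s \<and> regs s 13 = latest es)"
  proof (rule reachesI)
    fix s assume s: "choosing 56 v X out s \<and> regs s 13 = latest (e # es)"
    have i: "e div k < m" by (rule div_less_m[OF em])
    have rd: "mem s (links + e) = latest es"
      using s em e by (auto simp: choosing_def linked_def)
    \<comment> \<open>The link is loaded after the flag is written, so the two cells must
      differ.\<close>
    have bd: "flags + e div k < 2 ^ w" "links + e < 2 ^ w" "Suc e < 2 ^ w"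
      "flags + e div k \<noteq> links + e"
      using em i layout_bounds(3)[of "e div k"]
        layout_bounds(5)[of e] layout_bounds(10) by (auto simp: links_def)
    have "(step w hitting_program ^^ 8) s = s\<lparr>pc := 56, regs := (regs s)
        (16 := links + e, 13 := latest es), mem := (mem s)(flags + e div k := 1)\<rparr>"
      using s rd bd unfolding choosing_def constants_def
      by (simp add: symbolic_step latest_def[of "e # es"])
    then show "choosing 56 v (insert (e div k) X) out ((step w hitting_program ^^ 8) s) \<and>
        regs ((step w hitting_program ^^ 8) s) 13 = latest es"
      using s i by (simp add: choosing_def constants_def linked_def flagged_def emitted_def
        outs_def links_def flags_def)
  qed
  moreover have "reaches w hitting_program
      (\<lambda>s. choosing 56 v (insert (e div k) X) out s \<and> regs s 13 = latest es) (8 * length es + 2)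
      (choosing 32 v (insert (e div k) X \<union> (\<lambda>e. e div k) ` set es) out)"
    using Cons.prems em e by (intro Cons.IH[of e]) auto
  ultimately show ?case by (rule reaches_trans[THEN reaches_weaken]) auto
qed

lemma reaches_skip:
  assumes "d \<le> q"
  shows "reaches w hitting_program (\<lambda>s. choosing 49 v X out s \<and> regs s 15 = d) 2
    (choosing 32 v X out)"
proof (rule reachesI)
  fix s assume s: "choosing 49 v X out s \<and> regs s 15 = d"
  then have "(step w hitting_program ^^ 2) s = s\<lparr>pc := 32\<rparr>"
    using assms by (simp add: symbolic_step choosing_def constants_def)
  then show "choosing 32 v X out ((step w hitting_program ^^ 2) s)"
    using s by (simp add: choosing_def constants_def linked_def flagged_def emitted_def)
qed

lemma reaches_select:
  assumes "q < d" "1 \<le> v" "v \<le> n" "length out < n"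
  shows "reaches w hitting_program (\<lambda>s. choosing 49 v X out s \<and> regs s 15 = d) 6
    (\<lambda>s. choosing 56 v X (out @ [v]) s \<and> regs s 13 = latest (occs (m * k) v))"
proof (rule reachesI)
  fix s assume s: "choosing 49 v X out s \<and> regs s 15 = d"
  have rd: "mem s (heads + v) = latest (occs (m * k) v)"
    using s assms by (auto simp: choosing_def linked_def)
  have bd: "outs + length out < 2 ^ w" "heads + v < 2 ^ w" "Suc (length out) < 2 ^ w"
    "outs + length out \<noteq> heads + v"
    using assms layout_bounds(7)[of "length out"] layout_bounds(8) layout_bounds(1)[of v]
    by (auto simp: outs_def links_def flags_def)
  have "(step w hitting_program ^^ 6) s = s\<lparr>pc := 56, regs := (regs s)
      (16 := outs + length out, 1 := Suc (length out), 13 := latest (occs (m * k) v)),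
      mem := (mem s)(outs + length out := v)\<rparr>"
    using s rd bd assms(1) unfolding choosing_def constants_def emitted_def
    by (simp add: symbolic_step)
  then show "choosing 56 v X (out @ [v]) ((step w hitting_program ^^ 6) s) \<and>
      regs ((step w hitting_program ^^ 6) s) 13 = latest (occs (m * k) v)"
    using s assms by (simp add: choosing_def constants_def linked_def flagged_def emitted_def
      outs_def links_def flags_def nth_append less_Suc_eq)
qed

lemma length_occs_le: "length (occs E v) \<le> E"
  by (induction E) auto

text \<open>The costlier branch determines the bound: 5 steps to start,
  \<open>10 * length + 2\<close> to count, 6 to select and \<open>8 * length + 2\<close> to
  mark.\<close>

lemma reaches_choosing_Suc:
  assumes v: "v < n"
  shows "reaches w hitting_program (choosing 32 v (hit v) (chosen v))
    (15 + 18 * length (occs (m * k) (Suc v))) (choosing 32 (Suc v) (hit (Suc v)) (chosen (Suc v)))"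
proof -
  let ?es = "occs (m * k) (Suc v)" and ?d = "unhit (hit v) (Suc v)"
  have count: "reaches w hitting_program (choosing 32 v (hit v) (chosen v))
      (5 + (10 * length ?es + 2))
      (\<lambda>s. choosing 49 (Suc v) (hit v) (chosen v) s \<and> regs s 15 = ?d)"
    using reaches_trans[OF reaches_list_start[OF v, of "hit v" "chosen v"] reaches_count]
      length_occs_le[of "m * k" "Suc v"]
    by (simp add: unhit_def)
  show ?thesis
  proof (cases "q < ?d")
    case True
    have "length (chosen v) < n" using length_chosen_le[of v] v by simp
    then have "reaches w hitting_program
        (\<lambda>s. choosing 49 (Suc v) (hit v) (chosen v) s \<and> regs s 15 = ?d) 6
        (\<lambda>s. choosing 56 (Suc v) (hit v) (chosen v @ [Suc v]) s \<and> regs s 13 = latest ?es)"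
      using True v by (intro reaches_select) auto
    note select = reaches_trans[OF this reaches_mark[OF refl order_refl]]
    show ?thesis
      by (rule reaches_weaken[OF reaches_trans[OF count select]])
        (use True in \<open>auto simp: greedy_Suc owners_def\<close>)
  next
    case False
    then have skip: "reaches w hitting_program
        (\<lambda>s. choosing 49 (Suc v) (hit v) (chosen v) s \<and> regs s 15 = ?d) 2
        (choosing 32 (Suc v) (hit v) (chosen v))"
      by (intro reaches_skip) auto
    show ?thesis
      by (rule reaches_weaken[OF reaches_trans[OF count skip]])
        (use False in \<open>auto simp: greedy_Suc\<close>)
  qed
qed

section \<open>Total running time and output\<close>

lemma reaches_halt:
  "reaches w hitting_program (choosing 32 n X out) 2 (choosing 65 n X out)"
proof (rule reachesI)
  fix s assume s: "choosing 32 n X out s"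
  then have "(step w hitting_program ^^ 2) s = s\<lparr>pc := 65\<rparr>"
    by (simp add: symbolic_step choosing_def constants_def)
  then show "choosing 65 n X out ((step w hitting_program ^^ 2) s)"
    using s by (simp add: choosing_def constants_def linked_def flagged_def emitted_def)
qed

text \<open>The phases add up to \<open>20 + 15 * n + 33 * (m * k)\<close>; since \<open>n\<close>
  is positive, the constant 20 is absorbed into the coefficient of \<open>n\<close>.\<close>

lemma reaches_result:
  "reaches w hitting_program (\<lambda>s. s = init_state inp) (40 * (n + m * k))
    (choosing 65 n (hit n) (chosen n))"
proof -
  have "reaches w hitting_program (building 0) (\<Sum>e<m * k. 15) (building (m * k))"
    by (rule reaches_for) (rule reaches_building_Suc)
  note build = reaches_trans[OF reaches_trans[OF reaches_building_0 this] reaches_choosing_0]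
  have "reaches w hitting_program (choosing 32 0 (hit 0) (chosen 0))
      (\<Sum>v<n. 15 + 18 * length (occs (m * k) (Suc v))) (choosing 32 n (hit n) (chosen n))"
    by (rule reaches_for[where I = "\<lambda>v. choosing 32 v (hit v) (chosen v)"])
      (rule reaches_choosing_Suc)
  note choose = reaches_trans[OF this reaches_halt]
  have "(\<Sum>v<n. 15 + 18 * length (occs (m * k) (Suc v))) = 15 * n + 18 * (m * k)"
    by (simp add: sum.distrib sum_length_occs flip: sum_distrib_left)
  with reaches_trans[OF build choose[simplified]] n_pos show ?thesis
    by (auto elim!: reaches_weaken)
qed

lemma computes_chosen:
  obtains t where "computes_in w hitting_program inp t (chosen n)" "t \<le> 40 * (n + m * k)"
proof -
  obtain t where t: "t \<le> 40 * (n + m * k)"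
    and s: "choosing 65 n (hit n) (chosen n) ((step w hitting_program ^^ t) (init_state inp))"
    using reaches_result by (auto simp: reaches_def)
  have "outs + length (chosen n) \<le> 2 ^ w"
    using layout_bounds(7)[OF length_chosen_le] by simp
  then have "computes_in w hitting_program inp t (chosen n)"
    using s unfolding computes_in_def Let_def choosing_def constants_def emitted_def
    by (auto simp: halted_def result_array_def intro!: nth_equalityI)
  then show thesis using t that by blast
qed

end

section \<open>Transfer from lists to the family of sets\<close>

theorem theorem2p4:
  "\<exists>(P :: instr list) (\<epsilon> :: real) (C\<^sub>1 :: real) (C\<^sub>2 :: real) (c :: nat).
     \<epsilon> > 0 \<and>
     (\<forall>(n :: nat) (m :: nat) (k :: nat) (F :: nat \<Rightarrow> nat set) (xss :: nat list list) (w :: nat).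
        n \<ge> 1 \<longrightarrow> k \<ge> 1 \<longrightarrow>
        (\<forall>i \<in> {1..m}. F i \<subseteq> {1..n} \<and> card (F i) \<ge> k) \<longrightarrow>
        lists_family xss m F \<longrightarrow>
        c * (n + k + length (family_input n k xss)) \<le> 2 ^ w \<longrightarrow>
        (\<exists>t out S.
           computes_in w P (family_input n k xss) t out \<and>
           lists_set out S \<and>
           fractional_hitting_set \<epsilon> n m F S \<and>
           real (card S) \<le> C\<^sub>1 * (real n / real k) \<and>
           real t \<le> C\<^sub>2 * (real n + real m * real k + real n / real k * log 2 (real n))))"
proof (rule exI[of _ hitting_program], rule exI[of _ "1/2"], rule exI[of _ 2], rule exI[of _ 40],
    rule exI[of _ 2], intro conjI allI impI)
  \<comment> \<open>The witnesses 1/2, 2, 40 and 2 come from \<open>card_hit_ge\<close>,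
    \<open>length_chosen_mult_k\<close>, \<open>reaches_result\<close> and
    \<open>word_size\<close>.\<close>
  fix n m k w :: nat and F :: "nat \<Rightarrow> nat set" and xss :: "nat list list"
  assume n: "n \<ge> 1" and k: "k \<ge> 1"
    and F: "\<forall>i \<in> {1..m}. F i \<subseteq> {1..n} \<and> card (F i) \<ge> k"
    and xss: "lists_family xss m F"
    and w: "2 * (n + k + length (family_input n k xss)) \<le> 2 ^ w"
  have len: "length xss = m"
    and sets: "\<And>i. i < m \<Longrightarrow> distinct (xss ! i) \<and> set (xss ! i) = F (Suc i)"
    using xss by (auto simp: lists_family_def lists_set_def)
  have Fi: "F (Suc i) \<subseteq> {1..n} \<and> card (F (Suc i)) \<ge> k" if "i < m" for i
    using F that by auto
  interpret hitting_instance n m k w xss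
    using n k w len sets Fi by unfold_locales (auto, metis distinct_card)
  obtain t where t: "computes_in w hitting_program inp t (chosen n)" "t \<le> 40 * (n + m * k)"
    by (rule computes_chosen)
  let ?S = "set (chosen n)"
  \<comment> \<open>The sets in \<open>hit\<close> are numbered from 0, the family from 1.\<close>
  have "Suc ` hit n \<subseteq> {i \<in> {1..m}. ?S \<inter> F i \<noteq> {}}"
  proof clarify
    fix i assume "i \<in> hit n"
    then obtain v where v: "v \<in> ?S" "i \<in> owners v" unfolding hit_eq by blast
    then obtain e where e: "e < m * k" "elt e = v" "i = e div k"
      by (auto simp: owners_def set_occs)
    then have "v \<in> F (Suc i)" "i < m"
      using elt_mem[OF e(1)] sets[OF div_less_m[OF e(1)]] div_less_m[OF e(1)] by auto
    then show "Suc i \<in> {1..m} \<and> ?S \<inter> F (Suc i) \<noteq> {}" using v by auto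
  qed
  then have "card (Suc ` hit n) \<le> card {i \<in> {1..m}. ?S \<inter> F i \<noteq> {}}"
    by (intro card_mono) auto
  then have "m \<le> 2 * card {i \<in> {1..m}. ?S \<inter> F i \<noteq> {}}"
    using card_hit_ge by (simp add: card_image)
  then have hitting: "fractional_hitting_set (1/2) n m F ?S"
    using set_chosen[of n] by (simp add: fractional_hitting_set_def)
  have "real (length (chosen n) * k) \<le> real (2 * n)"
    using length_chosen_mult_k by (intro of_nat_mono)
  then have size: "real (card ?S) \<le> 2 * (real n / real k)"
    using k by (simp add: distinct_card[OF distinct_chosen] field_simps)
  have "real t \<le> 40 * (real n + real m * real k)"
    using of_nat_mono[OF t(2), where 'a = real] by simp
  \<comment> \<open>The logarithm is nonnegative for \<open>n\<close> at least 1, so its term may be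
    added to the linear bound.\<close>
  moreover have "0 \<le> real n / real k * log 2 (real n)" using n by simp
  ultimately have "real t \<le> 40 * (real n + real m * real k + real n / real k * log 2 (real n))"
    by argo
  then show "\<exists>t out S.
      computes_in w hitting_program inp t out \<and> lists_set out S \<and>
      fractional_hitting_set (1/2) n m F S \<and> real (card S) \<le> 2 * (real n / real k) \<and>
      real t \<le> 40 * (real n + real m * real k + real n / real k * log 2 (real n))"
    using t(1) hitting size distinct_chosen[of n] unfolding lists_set_def by blast
qed simp

end
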